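(* Let $n\ge1$ and let $\rho,\sigma\in DO(n)$ be states. Then $$D_\infty(\sigma\|\rho)\ \ge\ H_\infty(\rho)-H_\infty(\sigma)=\log\frac{\|\sigma\|}{\|\rho\|},$$ and equality holds if and only if $\rho\sqsubseteq\sigma$; that is, $$\rho\sqsubseteq\sigma\iff D_\infty(\sigma\|\rho)=\log\frac{\|\sigma\|}{\|\rho\|}.$$
   Context: $DO(n)=\{A\in M_n(\mathbb{C}) : A\ge 0,\ \operatorname{tr}A=1\}$ is the set of states, where $A\ge0$ means positive semidefinite and $A\le B$ means $B-A\ge 0$. $\|\cdot\|$ is the operator norm. The min-entropy of a state is $H_\infty(\rho)=-\log\|\rho\|$. The quantum max-divergence of states is $$D_\infty(\sigma\|\rho)=\inf\{\gamma\in\mathbb{R} : \sigma\le e^\gamma\rho\}\in(-\infty,\infty],$$ with the infimum of the empty set equal to $\infty$; $\log$ is the natural logarithm. The QPE order on $DO(n)$ is the partial order $$\rho\sqsubseteq\sigma \iff \frac{\sigma}{\|\sigma\|}\le\frac{\rho}{\|\rho\|}\iff \|\sigma\|\rho-\|\rho\|\sigma\ge 0 .$$ *)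

theory Defs
  imports "HOL-Analysis.Analysis"
begin

definition conj_transpose :: "complex ^ 'n ^ 'm \<Rightarrow> complex ^ 'm ^ 'n" where
  "conj_transpose A = (\<chi> i j. cnj (A $ j $ i))"

text \<open>The library inner product on \<open>complex ^ 'n\<close> is the real part of this sesquilinear one.\<close>

definition hermitian_inner :: "complex ^ 'n \<Rightarrow> complex ^ 'n \<Rightarrow> complex" where
  "hermitian_inner v w = (\<Sum>i\<in>UNIV. cnj (v $ i) * w $ i)"

text \<open>For self-adjoint \<open>A\<close> the quadratic form is real-valued, so \<open>Re\<close> discards nothing.\<close>

definition psd :: "complex ^ 'n ^ 'n \<Rightarrow> bool" where
  "psd A \<longleftrightarrow> conj_transpose A = A \<and> (\<forall>v. 0 \<le> Re (hermitian_inner v (A *v v)))"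

definition loewner_le :: "complex ^ 'n ^ 'n \<Rightarrow> complex ^ 'n ^ 'n \<Rightarrow> bool" where
  "loewner_le A B \<longleftrightarrow> psd (B - A)"

definition states :: "(complex ^ 'n ^ 'n) set" where
  "states = {A. psd A \<and> trace A = 1}"

text \<open>The norm of \<open>complex ^ 'n ^ 'n\<close> as a vector type is the Frobenius norm; the operator norm
  is \<^const>\<open>onorm\<close> of the matrix acting on \<open>complex ^ 'n\<close> with its Euclidean norm.\<close>

definition op_norm :: "complex ^ 'n ^ 'n \<Rightarrow> real" where
  "op_norm A = onorm (\<lambda>v. A *v v)"

definition min_entropy :: "complex ^ 'n ^ 'n \<Rightarrow> real" where
  "min_entropy \<rho> = - ln (op_norm \<rho>)"

text \<open>The infimum is taken in the extended reals, where that of the empty set is \<open>\<infinity>\<close>.\<close>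

definition max_divergence :: "complex ^ 'n ^ 'n \<Rightarrow> complex ^ 'n ^ 'n \<Rightarrow> ereal" where
  "max_divergence \<sigma> \<rho> = (INF \<gamma> \<in> {\<gamma> :: real. loewner_le \<sigma> (exp \<gamma> *\<^sub>R \<rho>)}. ereal \<gamma>)"

definition qpe_le :: "complex ^ 'n ^ 'n \<Rightarrow> complex ^ 'n ^ 'n \<Rightarrow> bool" where
  "qpe_le \<rho> \<sigma> \<longleftrightarrow> loewner_le (\<sigma> /\<^sub>R op_norm \<sigma>) (\<rho> /\<^sub>R op_norm \<rho>)"

end

theory Submission
  imports Defs
begin

text \<open>If \<open>\<sigma> \<le> e\<^sup>\<gamma>\<rho>\<close> then \<open>\<parallel>\<sigma>\<parallel> \<le> e\<^sup>\<gamma>\<parallel>\<rho>\<parallel>\<close>, because the operator norm is monotone on positive semidefinite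
  matrices; so every admissible \<open>\<gamma>\<close> is at least \<open>L = ln (\<parallel>\<sigma>\<parallel> / \<parallel>\<rho>\<parallel>)\<close>. The set of admissible \<open>\<gamma>\<close> is
  closed, so the infimum equals \<open>L\<close> exactly when \<open>L\<close> itself is admissible, and \<open>\<sigma> \<le> e\<^sup>L\<rho>\<close> is, after division
  by \<open>\<parallel>\<sigma>\<parallel>\<close>, the QPE order.\<close>

lemma Re_hermitian_inner: "Re (hermitian_inner v w) = v \<bullet> w"
  by (simp add: hermitian_inner_def inner_vec_def inner_complex_def)

lemma hermitian_inner_adjoint:
  "hermitian_inner v (A *v w) = hermitian_inner (conj_transpose A *v v) w"
proof -
  have "hermitian_inner v (A *v w) = (\<Sum>i\<in>UNIV. \<Sum>j\<in>UNIV. cnj (v $ i) * A $ i $ j * w $ j)"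
    by (simp add: hermitian_inner_def matrix_vector_mult_def sum_distrib_left mult.assoc)
  also have "\<dots> = (\<Sum>j\<in>UNIV. \<Sum>i\<in>UNIV. cnj (v $ i) * A $ i $ j * w $ j)"
    by (rule sum.swap)
  also have "\<dots> = hermitian_inner (conj_transpose A *v v) w"
    by (simp add: hermitian_inner_def conj_transpose_def matrix_vector_mult_def sum_distrib_left
        sum_distrib_right mult_ac)
  finally show ?thesis .
qed

text \<open>This supplies the symmetry hypothesis of \<open>norm_le_of_quadratic_form_le\<close>,
  which works in a real inner product space; taking real parts in the adjoint identity
  suffices.\<close>

lemma inner_hermitian_matrix:
  assumes "conj_transpose A = A"
  shows "v \<bullet> (A *v w) = (A *v v) \<bullet> w"
  using hermitian_inner_adjoint[of v A w] assms by (simp flip: Re_hermitian_inner)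

lemma scaleR_matrix_vector: "(r *\<^sub>R A) *v v = r *\<^sub>R (A *v v)" for A :: "complex ^ 'n ^ 'm"
  by (simp add: vec_eq_iff matrix_vector_mult_def scaleR_sum_right)

lemma conj_transpose_scaleR: "conj_transpose (r *\<^sub>R A) = r *\<^sub>R conj_transpose A"
  by (simp add: vec_eq_iff conj_transpose_def)

lemma conj_transpose_diff: "conj_transpose (A - B) = conj_transpose A - conj_transpose B"
  by (simp add: vec_eq_iff conj_transpose_def)

text \<open>Real multiples of self-adjoint matrices have a self-adjoint difference, so only the
  quadratic form matters. Both the divergence condition and the QPE order become inequalities of
  this shape.\<close>

lemma loewner_le_scaleR_iff:
  assumes "conj_transpose A = A" and "conj_transpose B = B"
  shows "loewner_le (r *\<^sub>R A) (s *\<^sub>R B) \<longleftrightarrow> (\<forall>v. r * (v \<bullet> (A *v v)) \<le> s * (v \<bullet> (B *v v)))"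
  using assms
  by (simp add: loewner_le_def psd_def Re_hermitian_inner conj_transpose_diff conj_transpose_scaleR
      matrix_vector_mult_diff_rdistrib scaleR_matrix_vector inner_diff_right)

text \<open>From 0 \<le> f \<le> c one gets f^2 \<le> c f \<le> c^2 as forms, and the form of f^2 at
  \<open>v\<close> is the squared norm of \<open>f v\<close>. This is purely algebraic, with no
  diagonalisation of \<open>f\<close>.\<close>

lemma norm_le_of_quadratic_form_le:
  fixes f :: "'a::real_inner \<Rightarrow> 'a"
  assumes lin: "linear f" and sym: "\<And>u v. u \<bullet> f v = f u \<bullet> v"
    and pos: "\<And>v. 0 \<le> v \<bullet> f v" and le: "\<And>v. v \<bullet> f v \<le> c * (v \<bullet> v)" and c: "0 < c"
  shows "norm (f v) \<le> c * norm v"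
proof -
  let ?u = "c *\<^sub>R v - f v"
  \<comment> \<open>\<open>c (c f - f\<^sup>2) = f (c - f) f + (c - f) f (c - f)\<close>, a sum of two positive operators\<close>
  have "c * (c * (v \<bullet> f v) - f v \<bullet> f v)
      = (c * (f v \<bullet> f v) - f v \<bullet> f (f v)) + ?u \<bullet> f ?u"
    using sym[of v "f v"] inner_commute[of "f v" v]
    by (simp add: linear_diff[OF lin] linear_scale[OF lin] inner_diff_left inner_diff_right
        right_diff_distrib)
  also have "\<dots> \<ge> 0"
    using le[of "f v"] pos[of ?u] by simp
  finally have "f v \<bullet> f v \<le> c * (v \<bullet> f v)"
    using c by (simp add: zero_le_mult_iff)
  also have "\<dots> \<le> c * (c * (v \<bullet> v))"
    using le[of v] c by simp
  finally have "(norm (f v))\<^sup>2 \<le> (c * norm v)\<^sup>2"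
    by (simp add: power2_norm_eq_inner power_mult_distrib power2_eq_square[of c] mult.assoc)
  then show ?thesis
    by (rule power2_le_imp_le) (use c in simp)
qed

lemma inner_le_op_norm: "v \<bullet> (A *v v) \<le> op_norm A * (v \<bullet> v)"
proof -
  have "v \<bullet> (A *v v) \<le> norm v * norm (A *v v)"
    by (rule norm_cauchy_schwarz)
  also have "\<dots> \<le> norm v * (op_norm A * norm v)"
    by (intro mult_left_mono) (simp_all add: op_norm_def onorm)
  finally show ?thesis
    by (simp add: power2_eq_square mult_ac flip: power2_norm_eq_inner)
qed

text \<open>Converse to \<open>inner_le_op_norm\<close> for positive matrices. Chaining the two
  gives monotonicity of the operator norm.\<close>

lemma op_norm_le_of_quadratic_form_le:
  assumes "psd A" and "\<And>v. v \<bullet> (A *v v) \<le> c * (v \<bullet> v)" and "0 < c"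
  shows "op_norm A \<le> c"
  unfolding op_norm_def
proof (rule onorm_le)
  fix v
  have lin: "linear ((*v) A)"
    by (simp add: bounded_linear.linear)
  show "norm (A *v v) \<le> c * norm v"
    using assms inner_hermitian_matrix
    by (intro norm_le_of_quadratic_form_le[OF lin]) (auto simp: psd_def Re_hermitian_inner)
qed

text \<open>Trace 1 excludes the zero matrix. Positivity makes the logarithms and the divisions by
  norms meaningful.\<close>

lemma op_norm_pos:
  assumes "A \<in> states"
  shows "0 < op_norm A"
proof -
  have "A \<noteq> 0"
    using assms by (auto simp: states_def trace_def)
  moreover have "A = 0" if "\<And>v. A *v v = 0"
    by (metis that matrix_eq matrix_vector_mult_0)
  ultimately have "op_norm A \<noteq> 0"
    by (auto simp: op_norm_def onorm_eq_0)
  then show ?thesis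
    using onorm_pos_le[of "(*v) A"] by (simp add: op_norm_def)
qed

theorem theorem17:
  fixes \<rho> \<sigma> :: "complex ^ 'n ^ 'n"
  assumes "\<rho> \<in> states" and "\<sigma> \<in> states"
  shows "max_divergence \<sigma> \<rho> \<ge> ereal (min_entropy \<rho> - min_entropy \<sigma>)
    \<and> min_entropy \<rho> - min_entropy \<sigma> = ln (op_norm \<sigma> / op_norm \<rho>)
    \<and> (max_divergence \<sigma> \<rho> = ereal (min_entropy \<rho> - min_entropy \<sigma>) \<longleftrightarrow> qpe_le \<rho> \<sigma>)
    \<and> (qpe_le \<rho> \<sigma> \<longleftrightarrow> max_divergence \<sigma> \<rho> = ereal (ln (op_norm \<sigma> / op_norm \<rho>)))"
proof -
  define L where "L = ln (op_norm \<sigma> / op_norm \<rho>)"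
  define S where "S = {\<gamma>. loewner_le \<sigma> (exp \<gamma> *\<^sub>R \<rho>)}"
  have pos: "0 < op_norm \<rho>" "0 < op_norm \<sigma>"
    using assms by (auto intro: op_norm_pos)
  have psd: "psd \<rho>" "psd \<sigma>"
    using assms by (auto simp: states_def)
  then have herm: "conj_transpose \<rho> = \<rho>" "conj_transpose \<sigma> = \<sigma>"
    by (auto simp: psd_def)
  have \<rho>_nonneg: "0 \<le> v \<bullet> (\<rho> *v v)" for v
    using psd by (simp add: psd_def Re_hermitian_inner)
  have exp_L: "exp L = op_norm \<sigma> / op_norm \<rho>"
    using pos by (simp add: L_def)
  have entropy: "min_entropy \<rho> - min_entropy \<sigma> = L"
    using pos by (simp add: min_entropy_def L_def ln_div)
  have div: "max_divergence \<sigma> \<rho> = (INF \<gamma>\<in>S. ereal \<gamma>)"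
    by (simp add: max_divergence_def S_def)
  have S_iff: "\<gamma> \<in> S \<longleftrightarrow> (\<forall>v. v \<bullet> (\<sigma> *v v) \<le> exp \<gamma> * (v \<bullet> (\<rho> *v v)))" for \<gamma>
    using loewner_le_scaleR_iff[OF herm(2,1), of 1 "exp \<gamma>"] by (simp add: S_def)
  have lower: "L \<le> \<gamma>" if "\<gamma> \<in> S" for \<gamma>
  proof -
    \<comment> \<open>The constant comes from the chain \<sigma> \<le> \<open>exp \<gamma>\<close>
      \<rho> \<le> \<open>exp \<gamma> * op_norm \<rho>\<close> times the identity.\<close>
    have "op_norm \<sigma> \<le> exp \<gamma> * op_norm \<rho>"
    proof (rule op_norm_le_of_quadratic_form_le[OF psd(2)])
      fix v
      have "v \<bullet> (\<sigma> *v v) \<le> exp \<gamma> * (v \<bullet> (\<rho> *v v))"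
        using that S_iff by blast
      also have "\<dots> \<le> exp \<gamma> * (op_norm \<rho> * (v \<bullet> v))"
        by (intro mult_left_mono inner_le_op_norm) simp
      finally show "v \<bullet> (\<sigma> *v v) \<le> exp \<gamma> * op_norm \<rho> * (v \<bullet> v)"
        by (simp add: mult.assoc)
    qed (use pos in simp)
    then have "exp L \<le> exp \<gamma>"
      using pos by (simp add: exp_L field_simps)
    then show ?thesis by simp
  qed
  then have ge: "ereal L \<le> max_divergence \<sigma> \<rho>"
    by (auto simp: div intro: INF_greatest)
  have attained: "L \<in> S" if eq: "max_divergence \<sigma> \<rho> = ereal L"
    unfolding S_iff
  proof
    fix v
    \<comment> \<open>Since \<rho> \<ge> 0, admissibility passes to larger exponents, so everything
      above the infimum is admissible.\<close>
    have "v \<bullet> (\<sigma> *v v) \<le> exp \<delta> * (v \<bullet> (\<rho> *v v))" if "L < \<delta>" for \<delta>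
    proof -
      have "(INF \<gamma>\<in>S. ereal \<gamma>) < ereal \<delta>"
        using eq that by (simp add: div)
      then obtain \<gamma> where \<gamma>: "\<gamma> \<in> S" "\<gamma> < \<delta>"
        by (auto simp: INF_less_iff)
      then have "v \<bullet> (\<sigma> *v v) \<le> exp \<gamma> * (v \<bullet> (\<rho> *v v))"
        using S_iff by blast
      also have "\<dots> \<le> exp \<delta> * (v \<bullet> (\<rho> *v v))"
        using \<gamma> \<rho>_nonneg by (intro mult_right_mono) auto
      finally show ?thesis .
    qed
    \<comment> \<open>With \<open>v\<close> fixed, the inequality survives the limit as \<delta>
      decreases to \<open>L\<close>, by continuity of \<open>exp\<close>.\<close>
    then have "\<forall>\<^sub>F \<delta> in at_right L. v \<bullet> (\<sigma> *v v) \<le> exp \<delta> * (v \<bullet> (\<rho> *v v))"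
      by (auto intro: eventually_at_rightI[of _ "L + 1"])
    moreover have "((\<lambda>\<delta>. exp \<delta> * (v \<bullet> (\<rho> *v v))) \<longlongrightarrow> exp L * (v \<bullet> (\<rho> *v v))) (at_right L)"
      by (intro tendsto_intros)
    ultimately show "v \<bullet> (\<sigma> *v v) \<le> exp L * (v \<bullet> (\<rho> *v v))"
      by (intro tendsto_lowerbound) auto
  qed
  have "max_divergence \<sigma> \<rho> = ereal L" if "L \<in> S"
    using ge that by (auto simp: div intro: antisym INF_lower)
  moreover have "qpe_le \<rho> \<sigma> \<longleftrightarrow> L \<in> S"
    using pos unfolding qpe_le_def loewner_le_scaleR_iff[OF herm(2,1)] S_iff exp_L
    by (simp add: field_simps)
  ultimately show ?thesis
    using ge attained entropy by (auto simp flip: L_def)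
qed

end
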